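(* Let $BD=(T,A,\{f_p:p\in A^P\})$ be basic data with associated $2$-graph $\Lambda_{BD}$, let $\Lambda_{BD}^\Delta$ be its two-sided infinite path space with shift homeomorphisms $\sigma^b$, and let $$Y_{BD}=\{y\in A^{\mathbb Z^2}: y\downarrow_{T+n}\in\Lambda_{BD}^0\text{ for every }n\in\mathbb Z^2\}$$ with shift maps $\sigma_b$. Then there is a homeomorphism $h:\Lambda_{BD}^\Delta\to Y_{BD}$ such that $\sigma_b\circ h=h\circ\sigma^b$ for every $b\in\mathbb Z^2$.
   Context: $\mathbb N=\{0,1,2,\dots\}$; $\mathbb N^2$ is a semigroup under addition with basis $e_1,e_2$ and the coordinatewise partial order $\le$ (also used on $\mathbb Z^2$). A tile $T$ is a nonempty finite subset of $\mathbb N^2$ that is hereditary ($n\in T$ and $0\le m\le n$ imply $m\in T$); $(c_1,c_2)$ denotes the coordinatewise maximum of the elements of $T$; $T$ is nondegenerate if $|T|\ge 2$. For nondegenerate $T$ put $P=T\setminus\{c_1e_1,c_2e_2\}$. Basic data is a triple $BD=(T,A,\{f_p:p\in A^P\})$ where $T$ is a nondegenerate tile, $A$ is a finite nonempty set, and for each function $p\in A^P$ (with $A^\emptyset=\{\emptyset\}$), $f_p:A\to A$ is a bijection. For $p\in A^P$, $a\in A$ define $F_{p,a}:T\to A$ by $F_{p,a}(c_2e_2)=a$, $F_{p,a}(c_1e_1)=f_p(a)$, $F_{p,a}(t)=p(t)$ for $t\in P$, and let $\Lambda_{BD}^0=\{F_{p,a}:p\in A^P,a\in A\}$. For a set $S$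 of lattice points and a lattice point $n$ let $S+n=\{m+n:m\in S\}$; for $n\in\mathbb N^2$ let $T(n)=\bigcup_{0\le m\le n}(T+m)$. If $f:S\to A$ with $T+n\subset S$, define $f\downarrow_{T+n}:T\to A$ by $f\downarrow_{T+n}(i)=f(i+n)$. A path of degree $n\in\mathbb N^2$ is a function $\lambda:T(n)\to A$ with $\lambda\downarrow_{T+m}\in\Lambda_{BD}^0$ for all $0\le m\le n$; its range is $r(\lambda)=\lambda\downarrow_T$ and its source is $s(\lambda)=\lambda\downarrow_{T+n}$. For $\lambda$ of degree $\ell$ and $0\le m\le n\le\ell$, $\lambda(m,n)$ is the path of degree $n-m$ given by $\lambda(m,n)(i)=\lambda(m+i)$ for $i\in T(n-m)$. The $2$-graph $\Lambda_{BD}$ is the category with objects $\Lambda_{BD}^0$, morphisms all paths, degree map $d$, and composite $\mu\nu$ (for $s(\mu)=r(\nu)$) the unique path $\lambda$ of degree $d(\mu)+d(\nu)$ with $\lambda(0,d(\mu))=\mu$, $\lambda(d(\mu),d(\mu)+d(\nu))=\nu$. $\Delta=\{(m,n):m,n\in\mathbb Z^2,\ m\le n\}$ is the $2$-graph with $r(m,n)=m$, $s(m,n)=n$, $d(m,n)=n-m$ and composition $(m,n)(n,l)=(m,l)$. For a $2$-graph $\Lambda$ without sinks or sources, $\Lambda^\Delta$ is the set of degree-preserving functors $x:\Delta\to\Lambda$, with the topology generated by the cylinder sets $Z(\lambda,n)=\{x\in\Lambda^\Delta:x(n,n+d(\lambda))=\lambda\}$, $\lambda\in\Lambda$, $n\in\mathbb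 Z^2$. For $b\in\mathbb Z^2$, $\sigma^b:\Lambda^\Delta\to\Lambda^\Delta$ is $\sigma^b(x)(m,n)=x(m+b,n+b)$. $A^{\mathbb Z^2}$ (all functions $\mathbb Z^2\to A$) has the product topology with $A$ discrete, $Y_{BD}$ has the subspace topology, and $\sigma_b(y)(i)=y(i+b)$. *)

theory Defs
  imports "HOL-Analysis.Analysis"
begin

text \<open>
  All lattice points live in \<open>\<int>\<^sup>2\<close>, with the coordinatewise addition and order of the product type.
  \<open>\<nat>\<^sup>2\<close> is the subset of the \<open>n\<close> with \<open>0 \<le> n\<close>, so that tiles, their translates by arbitrary
  points of \<open>\<int>\<^sup>2\<close>, and degrees all share one type.
  A function \<open>S \<rightarrow> A\<close> on a set of lattice points is an element of \<open>S \<rightarrow>\<^sub>E A\<close>.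
\<close>

type_synonym lattice = "int \<times> int"


subsection \<open>Basic data\<close>

definition tile :: "lattice set \<Rightarrow> bool" where
  "tile T \<longleftrightarrow> T \<noteq> {} \<and> finite T \<and> (\<forall>n\<in>T. 0 \<le> n) \<and>
     (\<forall>n\<in>T. \<forall>m. 0 \<le> m \<and> m \<le> n \<longrightarrow> m \<in> T)"

definition nondegenerate :: "lattice set \<Rightarrow> bool" where
  "nondegenerate T \<longleftrightarrow> card T \<ge> 2"

text \<open>The points \<open>c\<^sub>1e\<^sub>1\<close> and \<open>c\<^sub>2e\<^sub>2\<close>.\<close>

definition corner1 :: "lattice set \<Rightarrow> lattice" where
  "corner1 T = (Max (fst ` T), 0)"

definition corner2 :: "lattice set \<Rightarrow> lattice" where
  "corner2 T = (0, Max (snd ` T))"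

definition inner_tile :: "lattice set \<Rightarrow> lattice set" where
  "inner_tile T = T - {corner1 T, corner2 T}"

definition basic_data ::
    "lattice set \<Rightarrow> 'a set \<Rightarrow> ((lattice \<Rightarrow> 'a) \<Rightarrow> 'a \<Rightarrow> 'a) \<Rightarrow> bool" where
  "basic_data T A f \<longleftrightarrow> tile T \<and> nondegenerate T \<and> finite A \<and> A \<noteq> {} \<and>
     (\<forall>p \<in> inner_tile T \<rightarrow>\<^sub>E A. bij_betw (f p) A A)"

definition vertex_fun ::
    "lattice set \<Rightarrow> ((lattice \<Rightarrow> 'a) \<Rightarrow> 'a \<Rightarrow> 'a) \<Rightarrow> (lattice \<Rightarrow> 'a) \<Rightarrow> 'a \<Rightarrow> lattice \<Rightarrow> 'a" where
  "vertex_fun T f p a =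
     (\<lambda>t\<in>T. if t = corner2 T then a else if t = corner1 T then f p a else p t)"

definition vertices ::
    "lattice set \<Rightarrow> 'a set \<Rightarrow> ((lattice \<Rightarrow> 'a) \<Rightarrow> 'a \<Rightarrow> 'a) \<Rightarrow> (lattice \<Rightarrow> 'a) set" where
  "vertices T A f = {vertex_fun T f p a | p a. p \<in> inner_tile T \<rightarrow>\<^sub>E A \<and> a \<in> A}"


subsection \<open>Paths\<close>

definition translate :: "lattice set \<Rightarrow> lattice \<Rightarrow> lattice set" where
  "translate S n = (\<lambda>m. m + n) ` S"

definition tile_upto :: "lattice set \<Rightarrow> lattice \<Rightarrow> lattice set" where
  "tile_upto T n = (\<Union>m\<in>{0..n}. translate T m)"

text \<open>\<open>down T n g\<close> is \<open>g\<down>\<^bsub>T+n\<^esub>\<close>.\<close>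

definition down :: "lattice set \<Rightarrow> lattice \<Rightarrow> (lattice \<Rightarrow> 'a) \<Rightarrow> lattice \<Rightarrow> 'a" where
  "down T n g = (\<lambda>i\<in>T. g (i + n))"

text \<open>
  An element of \<open>S \<rightarrow>\<^sub>E A\<close> need not determine \<open>S\<close> (the value \<open>undefined\<close> may lie in \<open>A\<close>), so a path
  is stored together with its degree, as a pair \<open>(n, g)\<close> with \<open>g\<close> a function on \<open>T(n)\<close>.
\<close>

type_synonym 'a path = "lattice \<times> (lattice \<Rightarrow> 'a)"

definition paths ::
    "lattice set \<Rightarrow> 'a set \<Rightarrow> ((lattice \<Rightarrow> 'a) \<Rightarrow> 'a \<Rightarrow> 'a) \<Rightarrow> 'a path set" where
  "paths T A f = {(n, g) | n g. 0 \<le> n \<and> g \<in> tile_upto T n \<rightarrow>\<^sub>E A \<and>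
     (\<forall>m. 0 \<le> m \<and> m \<le> n \<longrightarrow> down T m g \<in> vertices T A f)}"

definition segment :: "lattice set \<Rightarrow> 'a path \<Rightarrow> lattice \<Rightarrow> lattice \<Rightarrow> 'a path" where
  "segment T l m n = (n - m, \<lambda>i\<in>tile_upto T (n - m). snd l (m + i))"

definition path_comp ::
    "lattice set \<Rightarrow> 'a set \<Rightarrow> ((lattice \<Rightarrow> 'a) \<Rightarrow> 'a \<Rightarrow> 'a) \<Rightarrow> 'a path \<Rightarrow> 'a path \<Rightarrow> 'a path" where
  "path_comp T A f u v = (THE l. l \<in> paths T A f \<and> fst l = fst u + fst v \<and>
     segment T l 0 (fst u) = u \<and> segment T l (fst u) (fst u + fst v) = v)"


subsection \<open>Small categories with a degree map\<close>

text \<open>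
  The structure underlying a 2-graph. Composition is in the 2-graph order: \<open>cmp C u v\<close> is
  meaningful when \<open>src C u = rng C v\<close>.
\<close>

record ('o, 'm) graph2 =
  objs :: "'o set"
  mors :: "'m set"
  rng :: "'m \<Rightarrow> 'o"
  src :: "'m \<Rightarrow> 'o"
  ident :: "'o \<Rightarrow> 'm"
  cmp :: "'m \<Rightarrow> 'm \<Rightarrow> 'm"
  deg :: "'m \<Rightarrow> lattice"

definition graph_BD ::
    "lattice set \<Rightarrow> 'a set \<Rightarrow> ((lattice \<Rightarrow> 'a) \<Rightarrow> 'a \<Rightarrow> 'a) \<Rightarrow> (lattice \<Rightarrow> 'a, 'a path) graph2" where
  "graph_BD T A f =
     \<lparr>objs = vertices T A f,
      mors = paths T A f,
      rng = (\<lambda>l. down T 0 (snd l)),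
      src = (\<lambda>l. down T (fst l) (snd l)),
      ident = (\<lambda>v. (0, v)),
      cmp = path_comp T A f,
      deg = fst\<rparr>"

definition Delta :: "(lattice, lattice \<times> lattice) graph2" where
  "Delta =
     \<lparr>objs = UNIV,
      mors = {(m, n). m \<le> n},
      rng = fst,
      src = snd,
      ident = (\<lambda>n. (n, n)),
      cmp = (\<lambda>u v. (fst u, snd v)),
      deg = (\<lambda>u. snd u - fst u)\<rparr>"

text \<open>A functor is the pair of its object map and its morphism map.\<close>

definition is_functor ::
    "('o, 'm) graph2 \<Rightarrow> ('p, 'n) graph2 \<Rightarrow> ('o \<Rightarrow> 'p) \<times> ('m \<Rightarrow> 'n) \<Rightarrow> bool" where
  "is_functor C D x \<longleftrightarrow>
     fst x \<in> objs C \<rightarrow>\<^sub>E objs D \<and>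
     snd x \<in> mors C \<rightarrow>\<^sub>E mors D \<and>
     (\<forall>u\<in>mors C. rng D (snd x u) = fst x (rng C u) \<and> src D (snd x u) = fst x (src C u)) \<and>
     (\<forall>v\<in>objs C. snd x (ident C v) = ident D (fst x v)) \<and>
     (\<forall>u\<in>mors C. \<forall>v\<in>mors C. src C u = rng C v \<longrightarrow>
        snd x (cmp C u v) = cmp D (snd x u) (snd x v))"

definition degree_preserving ::
    "('o, 'm) graph2 \<Rightarrow> ('p, 'n) graph2 \<Rightarrow> ('o \<Rightarrow> 'p) \<times> ('m \<Rightarrow> 'n) \<Rightarrow> bool" where
  "degree_preserving C D x \<longleftrightarrow> (\<forall>u\<in>mors C. deg D (snd x u) = deg C u)"


subsection \<open>The two-sided infinite path space\<close>

type_synonym ('o, 'm) inf_path = "(lattice \<Rightarrow> 'o) \<times> (lattice \<times> lattice \<Rightarrow> 'm)"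

definition two_sided_paths :: "('o, 'm) graph2 \<Rightarrow> ('o, 'm) inf_path set" where
  "two_sided_paths L = {x. is_functor Delta L x \<and> degree_preserving Delta L x}"

definition cylinder :: "('o, 'm) graph2 \<Rightarrow> 'm \<Rightarrow> lattice \<Rightarrow> ('o, 'm) inf_path set" where
  "cylinder L l n = {x \<in> two_sided_paths L. snd x (n, n + deg L l) = l}"

text \<open>The cylinders cover \<^term>\<open>two_sided_paths L\<close>, which is therefore the whole space.\<close>

definition two_sided_topology :: "('o, 'm) graph2 \<Rightarrow> ('o, 'm) inf_path topology" where
  "two_sided_topology L = topology_generated_by {cylinder L l n | l n. l \<in> mors L}"

text \<open>
  No restriction to \<open>m \<le> n\<close> is needed: translation by \<open>b\<close> preserves the order, so the shifted
  morphism map is again \<open>undefined\<close> off the morphisms of \<^term>\<open>Delta\<close>.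
\<close>

definition path_shift :: "lattice \<Rightarrow> ('o, 'm) inf_path \<Rightarrow> ('o, 'm) inf_path" where
  "path_shift b x = ((\<lambda>n. fst x (n + b)), (\<lambda>(m, n). snd x (m + b, n + b)))"


subsection \<open>The two-dimensional shift space\<close>

definition shift_space ::
    "lattice set \<Rightarrow> 'a set \<Rightarrow> ((lattice \<Rightarrow> 'a) \<Rightarrow> 'a \<Rightarrow> 'a) \<Rightarrow> (lattice \<Rightarrow> 'a) set" where
  "shift_space T A f = {y \<in> UNIV \<rightarrow>\<^sub>E A. \<forall>n. down T n y \<in> vertices T A f}"

definition shift_topology ::
    "lattice set \<Rightarrow> 'a set \<Rightarrow> ((lattice \<Rightarrow> 'a) \<Rightarrow> 'a \<Rightarrow> 'a) \<Rightarrow> (lattice \<Rightarrow> 'a) topology" where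
  "shift_topology T A f =
     subtopology (product_topology (\<lambda>_. discrete_topology A) UNIV) (shift_space T A f)"

definition lattice_shift :: "lattice \<Rightarrow> (lattice \<Rightarrow> 'a) \<Rightarrow> lattice \<Rightarrow> 'a" where
  "lattice_shift b y = (\<lambda>i. y (i + b))"

end

theory Submission
  imports Defs
begin

text \<open>
  A two-sided infinite path \<open>x\<close> carries the same information as the configuration \<open>y\<close> that records,
  at each lattice point \<open>i\<close>, the value at the origin of the vertex \<open>x(i)\<close>. The homeomorphism
  (\<open>config\<close>) reads off these values; its inverse (\<open>unfold_config\<close>) sends \<open>y\<close> to the functor whose
  value on \<open>(m, n)\<close> is the part of \<open>y\<close> on \<open>T(n - m) + m\<close>, recentred at the origin. Equivariance
  under the shifts is then immediate from the formulas.

  Why these maps are mutually inverse: a path is determined by the tile patterns that it shows at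
  the positions \<open>j\<close> between \<open>0\<close> and its degree, and functoriality forces the pattern of \<open>x(m, n)\<close>
  at position \<open>k - m\<close> to be the vertex \<open>x(k)\<close> (\<open>down_infinite_path\<close>). For \<open>t\<close> in the tile, the
  path \<open>x(n, n + t)\<close> therefore contains both \<open>x(n)\<close> and \<open>x(n + t)\<close>; its value at \<open>t\<close> is the value
  of \<open>x(n)\<close> at \<open>t\<close> and also the value of \<open>x(n + t)\<close> at the origin. So the vertex \<open>x(n)\<close> is the
  tile pattern of the configuration at \<open>n\<close> (\<open>down_config\<close>).

  The passage from functors to segments and back rests on the fact that the composite of two paths
  exists and is unique (\<open>unique_composite\<close>): composition is a definite description, which says
  nothing until both are known. Let \<open>m\<close> be the degree of the first factor. The factors prescribe
  the patterns at the positions that are comparable with \<open>m\<close>. At a position to the upper left of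
  \<open>m\<close>, once the tiles one step to the right and one step below are filled, only the upper corner
  \<open>c\<^sub>2e\<^sub>2\<close> of the tile is open, and the bijection \<open>f\<^sub>p\<close> says that exactly one symbol there completes
  the tile to a vertex; to the lower right the corner \<open>c\<^sub>1e\<^sub>1\<close> plays this part. Both existence
  (\<open>fill_positions\<close>) and uniqueness (\<open>determined_by_comparable_positions\<close>) follow by working
  outwards from \<open>m\<close> in the order of the \<open>\<ell>\<^sup>1\<close> distance.

  Both maps are continuous since a cylinder set of paths constrains a configuration on the finite
  set \<open>T(n)\<close>, while the value of a configuration at a single point is decided by a cylinder set of
  degree \<open>0\<close>.
\<close>

text \<open>Lattice points are treated as single objects; splitting their quantifiers into coordinates
  would obstruct matching against facts about points.\<close>

declare split_paired_All [simp del] split_paired_Ex [simp del]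

section \<open>Tiles and vertices\<close>

lemma down_eq_iff: "down T j g = down T j' g' \<longleftrightarrow> (\<forall>t\<in>T. g (t + j) = g' (t + j'))"
  by (auto simp: down_def fun_eq_iff restrict_def)

lemma mem_tile_upto_iff: "i \<in> tile_upto T n \<longleftrightarrow> (\<exists>k\<in>{0..n}. \<exists>t\<in>T. i = t + k)"
  unfolding tile_upto_def translate_def UN_iff image_iff ..

lemma tile_upto_memI: "t \<in> T \<Longrightarrow> 0 \<le> k \<Longrightarrow> k \<le> n \<Longrightarrow> t + k \<in> tile_upto T n"
  unfolding mem_tile_upto_iff by (intro bexI[of _ t] bexI[of _ k]) simp_all

lemma tile_upto_memE:
  assumes "i \<in> tile_upto T n"
  obtains t k where "t \<in> T" "0 \<le> k" "k \<le> n" "i = t + k"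
proof -
  obtain k t where "k \<in> {0..n}" "t \<in> T" "i = t + k"
    using assms unfolding mem_tile_upto_iff by (elim bexE)
  with that[of t k] show thesis
    by simp
qed

lemma tile_upto_0: "tile_upto T 0 = T"
proof -
  have "{0..0::lattice} = {0}"
    by (rule atLeastAtMost_singleton)
  then show ?thesis
    by (simp add: tile_upto_def translate_def)
qed
     
lemma finite_lattice_interval: "finite {a..b::lattice}"
proof (rule finite_subset)
  show "{a..b} \<subseteq> {fst a..fst b} \<times> {snd a..snd b}"
  proof
    fix i assume "i \<in> {a..b}"
    then have "fst a \<le> fst i \<and> snd a \<le> snd i" "fst i \<le> fst b \<and> snd i \<le> snd b"
      by (simp_all only: atLeastAtMost_iff less_eq_prod_def)
    then show "i \<in> {fst a..fst b} \<times> {snd a..snd b}"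
      by (simp add: mem_Times_iff)
  qed
  show "finite ({fst a..fst b} \<times> {snd a..snd b})"
    by simp
qed

lemma finite_tile_upto: "finite T \<Longrightarrow> finite (tile_upto T n)"
  unfolding tile_upto_def translate_def
  by (intro finite_UN_I finite_imageI finite_lattice_interval)

text \<open>The path of degree \<open>n\<close> that is visible in \<open>g\<close> from the point \<open>a\<close>. It serves both for segments
  of paths and for the paths cut out of a configuration on the whole lattice.\<close>

definition window :: "lattice set \<Rightarrow> (lattice \<Rightarrow> 'a) \<Rightarrow> lattice \<Rightarrow> lattice \<Rightarrow> 'a path" where
  "window T g a n = (n, \<lambda>i\<in>tile_upto T n. g (a + i))"

lemma segment_eq_window: "segment T l m n = window T (snd l) m (n - m)"
  by (simp add: segment_def window_def)

lemma fst_window [simp]: "fst (window T g a n) = n"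
  by (simp add: window_def)

lemma down_window:
  assumes "0 \<le> j" "j \<le> n"
  shows "down T j (snd (window T g a n)) = down T (a + j) g"
  using tile_upto_memI[OF _ assms] by (auto simp: down_eq_iff window_def algebra_simps)

lemma window_eq_iff:
  assumes "snd l \<in> extensional (tile_upto T (fst l))"
  shows "window T g a n = l \<longleftrightarrow> fst l = n \<and> (\<forall>i\<in>tile_upto T n. g (a + i) = snd l i)"
  using assms by (cases l) (auto simp: window_def fun_eq_iff restrict_def extensional_def)

text \<open>Equality of paths is an equality of tile patterns, because \<open>T(n)\<close> is covered by the tiles at
  the positions up to \<open>n\<close>. All later comparisons of paths are made position by position.\<close>

lemma window_eq_iff_down:
  assumes "snd l \<in> extensional (tile_upto T (fst l))"
  shows "window T g a n = l \<longleftrightarrow>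
    fst l = n \<and> (\<forall>j. 0 \<le> j \<longrightarrow> j \<le> n \<longrightarrow> down T (a + j) g = down T j (snd l))"
  (is "_ \<longleftrightarrow> ?R")
proof
  assume "window T g a n = l"
  then show ?R
    using down_window[of _ n T g a] by auto
next
  assume R: ?R
  have "g (a + i) = snd l i" if "i \<in> tile_upto T n" for i
  proof -
    from that obtain t j where tj: "t \<in> T" "0 \<le> j" "j \<le> n" "i = t + j"
      by (rule tile_upto_memE)
    with R have "down T (a + j) g = down T j (snd l)"
      by blast
    then have "g (t + (a + j)) = snd l (t + j)"
      using tj(1) unfolding down_eq_iff by blast
    then show ?thesis
      by (simp add: tj(4) algebra_simps)
  qed
  with R show "window T g a n = l"
    by (simp add: window_eq_iff[OF assms])
qed

locale basic_data_graph =
  fixes T :: "lattice set" and A :: "'a set" and f :: "(lattice \<Rightarrow> 'a) \<Rightarrow> 'a \<Rightarrow> 'a"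
  assumes basic_data: "basic_data T A f"
begin

lemma finite_T: "finite T" and T_nonempty: "T \<noteq> {}"
  and T_nonneg: "t \<in> T \<Longrightarrow> 0 \<le> t"
  and T_hereditary: "t \<in> T \<Longrightarrow> 0 \<le> m \<Longrightarrow> m \<le> t \<Longrightarrow> m \<in> T"
proof -
  have "tile T"
    using basic_data by (simp add: basic_data_def)
  then show "finite T" "T \<noteq> {}" "t \<in> T \<Longrightarrow> 0 \<le> t"
    "t \<in> T \<Longrightarrow> 0 \<le> m \<Longrightarrow> m \<le> t \<Longrightarrow> m \<in> T"
    unfolding tile_def by blast+
qed

lemma T_0: "0 \<in> T"
proof -
  obtain t where "t \<in> T"
    using T_nonempty by auto
  with T_hereditary[of t 0] T_nonneg[of t] show ?thesis
    by simp
qed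

lemma A_nonempty: "A \<noteq> {}"
  using basic_data by (simp add: basic_data_def)

lemma f_bij: "p \<in> inner_tile T \<rightarrow>\<^sub>E A \<Longrightarrow> bij_betw (f p) A A"
  using basic_data by (simp add: basic_data_def)

lemma fst_le_corner1: "t \<in> T \<Longrightarrow> fst t \<le> fst (corner1 T)"
  by (simp add: corner1_def finite_T)

lemma snd_le_corner2: "t \<in> T \<Longrightarrow> snd t \<le> snd (corner2 T)"
  by (simp add: corner2_def finite_T)

lemma corner1_in_T: "corner1 T \<in> T"
proof -
  have "Max (fst ` T) \<in> fst ` T"
    by (simp add: finite_T T_nonempty)
  then obtain t where t: "t \<in> T" "fst t = Max (fst ` T)"
    by (metis imageE)
  with T_nonneg[OF t(1)] show ?thesis
    by (intro T_hereditary[OF t(1)]) (auto simp: corner1_def less_eq_prod_def)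
qed

lemma corner2_in_T: "corner2 T \<in> T"
proof -
  have "Max (snd ` T) \<in> snd ` T"
    by (simp add: finite_T T_nonempty)
  then obtain t where t: "t \<in> T" "snd t = Max (snd ` T)"
    by (metis imageE)
  with T_nonneg[OF t(1)] show ?thesis
    by (intro T_hereditary[OF t(1)]) (auto simp: corner2_def less_eq_prod_def)
qed

text \<open>This is where nondegeneracy enters: with a single point, both corners would be the origin.\<close>

lemma corners_distinct: "corner1 T \<noteq> corner2 T"
proof
  assume eq: "corner1 T = corner2 T"
  have "T \<subseteq> {0}"
  proof
    fix t assume t: "t \<in> T"
    have "fst t \<le> 0" "snd t \<le> 0"
      using fst_le_corner1[OF t] snd_le_corner2[OF t] eq by (auto simp: corner1_def corner2_def)
    then show "t \<in> {0}"
      using T_nonneg[OF t] by (auto simp: less_eq_prod_def prod_eq_iff)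
  qed
  then have "card T \<le> 1"
    using card_mono[of "{0}" T] by simp
  then show False
    using basic_data by (simp add: basic_data_def nondegenerate_def)
qed

text \<open>The form in which vertices are used from here on: the pattern at \<open>j\<close> is a vertex when its entries
  are symbols and the two corner entries are related by the bijection that belongs to the rest.\<close>

lemma down_in_vertices_iff:
  "down T j g \<in> vertices T A f \<longleftrightarrow> (\<forall>t\<in>T. g (t + j) \<in> A) \<and>
     g (corner1 T + j) = f (down (inner_tile T) j g) (g (corner2 T + j))"
  (is "?L \<longleftrightarrow> ?R")
proof
  assume ?L
  then obtain p a where p: "p \<in> inner_tile T \<rightarrow>\<^sub>E A" and a: "a \<in> A"
    and eq: "down T j g = vertex_fun T f p a"
    by (auto simp: vertices_def)
  have val: "g (t + j) = (if t = corner2 T then a else if t = corner1 T then f p a else p t)"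
    if "t \<in> T" for t
    using fun_cong[OF eq, of t] that by (simp add: down_def vertex_fun_def)
  have "down (inner_tile T) j g = p"
    using p by (intro ext) (auto simp: down_def inner_tile_def val restrict_def PiE_def extensional_def)
  moreover have "f p a \<in> A"
    using f_bij[OF p] a by (auto simp: bij_betw_def)
  moreover have "p t \<in> A" if "t \<in> T" "t \<noteq> corner1 T" "t \<noteq> corner2 T" for t
    using p that by (auto simp: inner_tile_def)
  ultimately show ?R
    using a corners_distinct by (auto simp: val corner1_in_T corner2_in_T)
next
  assume R: ?R
  have "down T j g = vertex_fun T f (down (inner_tile T) j g) (g (corner2 T + j))"
    using R by (intro ext) (auto simp: down_def vertex_fun_def inner_tile_def restrict_def)
  moreover have "down (inner_tile T) j g \<in> inner_tile T \<rightarrow>\<^sub>E A"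
    using R by (auto simp: down_def inner_tile_def)
  ultimately show ?L
    using R corner2_in_T unfolding vertices_def by blast
qed

lemma down_inner_cong:
  assumes "\<And>t. t \<in> T \<Longrightarrow> t \<noteq> corner1 T \<Longrightarrow> t \<noteq> corner2 T \<Longrightarrow> g (t + j) = g' (t + j)"
  shows "down (inner_tile T) j g = down (inner_tile T) j g'"
  using assms by (auto simp: down_eq_iff inner_tile_def)

text \<open>Either corner can be filled: \<open>f\<^sub>p\<close> maps into \<open>A\<close> for the corner \<open>c\<^sub>1e\<^sub>1\<close>, and is onto \<open>A\<close> for the
  corner \<open>c\<^sub>2e\<^sub>2\<close>. The other entries may be any symbols, because there is a bijection for every \<open>p\<close>.\<close>

lemma complete_corner:
  assumes g: "\<And>i. g i \<in> A" and c: "c = corner1 T \<or> c = corner2 T"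
  shows "\<exists>a\<in>A. down T j (g(c + j := a)) \<in> vertices T A f"
proof -
  define p where "p = down (inner_tile T) j g"
  have p: "p \<in> inner_tile T \<rightarrow>\<^sub>E A"
    using g by (auto simp: p_def down_def)
  have p': "down (inner_tile T) j (g(c + j := a)) = p" for a
    unfolding p_def using c by (intro down_inner_cong) auto
  have bij: "f p ` A = A"
    using f_bij[OF p] by (simp add: bij_betw_def)
  have crit: "down T j (g(c + j := a)) \<in> vertices T A f \<longleftrightarrow>
      (g(c + j := a)) (corner1 T + j) = f p ((g(c + j := a)) (corner2 T + j))" if "a \<in> A" for a
    using g that by (simp add: down_in_vertices_iff p')
  show ?thesis
  proof (cases "c = corner1 T")
    case True
    define a where "a = f p (g (corner2 T + j))"
    have "a \<in> A"
      using bij g unfolding a_def by blast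
    then show ?thesis
      using True corners_distinct crit[OF \<open>a \<in> A\<close>]
      by (intro bexI[of _ a]) (simp_all add: a_def)
  next
    case False
    obtain a where a: "a \<in> A" "f p a = g (corner1 T + j)"
      using bij g[of "corner1 T + j"] by (metis imageE)
    then show ?thesis
      using c False crit[OF a(1)] by (intro bexI[of _ a]) simp_all
  qed
qed

text \<open>The corner \<open>c\<^sub>1e\<^sub>1\<close> is a function of the rest, and injectivity of \<open>f\<^sub>p\<close> makes \<open>c\<^sub>2e\<^sub>2\<close> one as
  well.\<close>

lemma corner_determined:
  assumes g: "down T j g \<in> vertices T A f" and g': "down T j g' \<in> vertices T A f"
    and c: "c = corner1 T \<or> c = corner2 T"
    and eq: "\<And>t. t \<in> T \<Longrightarrow> t \<noteq> c \<Longrightarrow> g (t + j) = g' (t + j)"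
  shows "down T j g = down T j g'"
proof -
  define p where "p = down (inner_tile T) j g"
  have p': "down (inner_tile T) j g' = p"
    unfolding p_def using c eq by (intro down_inner_cong) auto
  have "p \<in> inner_tile T \<rightarrow>\<^sub>E A"
    using g unfolding down_in_vertices_iff by (auto simp: p_def down_def inner_tile_def)
  from f_bij[OF this] have inj: "inj_on (f p) A"
    by (simp add: bij_betw_def)
  have 1: "g (corner1 T + j) = f p (g (corner2 T + j))"
    "g' (corner1 T + j) = f p (g' (corner2 T + j))"
    using g g' p' by (auto simp: down_in_vertices_iff p_def)
  have 2: "g (corner2 T + j) \<in> A" "g' (corner2 T + j) \<in> A"
    using g g' corner2_in_T by (auto simp: down_in_vertices_iff)
  have "g (c + j) = g' (c + j)"
    using c
  proof
    assume "c = corner1 T"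
    then show ?thesis
      using 1 eq[OF corner2_in_T] corners_distinct by auto
  next
    assume "c = corner2 T"
    then show ?thesis
      using 1 2 inj eq[OF corner1_in_T] corners_distinct by (auto simp: inj_on_def)
  qed
  with eq show ?thesis
    by (auto simp: down_eq_iff)
qed

section \<open>Existence and uniqueness of composites\<close>

text \<open>The upper corner of the tile at \<open>k\<close> lies on its left edge at maximal height. A tile that starts
  further right misses the edge, and a tile that starts lower does not reach the height.\<close>

lemma corner2_fresh:
  assumes "fst k < fst j \<or> snd j < snd k" and "t \<in> T"
  shows "t + j \<noteq> corner2 T + k"
proof
  assume "t + j = corner2 T + k"
  then have "fst t + fst j = fst k" "snd t + snd j = snd (corner2 T) + snd k"
    by (auto simp: prod_eq_iff corner2_def)
  with assms T_nonneg[of t] snd_le_corner2[of t] show False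
    by (auto simp: less_eq_prod_def)
qed

lemma corner1_fresh:
  assumes "fst j < fst k \<or> snd k < snd j" and "t \<in> T"
  shows "t + j \<noteq> corner1 T + k"
proof
  assume "t + j = corner1 T + k"
  then have "snd t + snd j = snd k" "fst t + fst j = fst (corner1 T) + fst k"
    by (auto simp: prod_eq_iff corner1_def)
  with assms T_nonneg[of t] fst_le_corner1[of t] show False
    by (auto simp: less_eq_prod_def)
qed

text \<open>
  Existence of fillings. The positions of \<open>K\<close> lie to the upper left or to the lower right of \<open>m\<close> and
  are treated in the order of increasing distance from \<open>m\<close>. When the turn of \<open>k\<close> comes, the entry
  at one corner of its tile is overwritten so that a vertex appears there. That corner belongs to no
  tile treated before and to no tile at \<open>J\<close>, so the vertices that are already there survive.
\<close>

lemma fill_positions: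
  fixes m :: lattice
  assumes g: "\<And>i. g i \<in> A"
    and J: "\<And>j. j \<in> J \<Longrightarrow> j \<le> m \<or> m \<le> j"
    and ver: "\<And>j. j \<in> J \<Longrightarrow> down T j g \<in> vertices T A f"
    and K: "finite K" "\<And>j. j \<in> K \<Longrightarrow> \<not> j \<le> m \<and> \<not> m \<le> j"
  shows "\<exists>g'. (\<forall>i. g' i \<in> A) \<and> (\<forall>j\<in>J. down T j g' = down T j g) \<and>
    (\<forall>j\<in>J \<union> K. down T j g' \<in> vertices T A f)"
proof -
  define rank where "rank = (\<lambda>j. \<bar>fst j - fst m\<bar> + \<bar>snd j - snd m\<bar>)"
  from K show ?thesis
  proof (induction K rule: finite_ranking_induct[where f = rank])
    case empty
    then show ?case
      using g ver by (intro exI[of _ g]) auto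
  next
    case (insert k S)
    then obtain g' where g': "\<forall>i. g' i \<in> A" "\<forall>j\<in>J. down T j g' = down T j g"
      "\<forall>j\<in>J \<union> S. down T j g' \<in> vertices T A f"
      by auto
    define c where "c = (if fst k < fst m then corner2 T else corner1 T)"
    have "c = corner1 T \<or> c = corner2 T"
      by (simp add: c_def)
    with complete_corner[of g' c k] g'(1) obtain a where a: "a \<in> A"
      "down T k (g'(c + k := a)) \<in> vertices T A f"
      by auto
    have k: "\<not> k \<le> m" "\<not> m \<le> k"
      using insert.prems by auto
    \<comment> \<open>Positions at the same distance on the same side of \<open>m\<close> lie on a common diagonal and do not
      interfere, so ties in the rank are harmless.\<close>
    have fresh: "t + j \<noteq> c + k" if j: "j \<in> J \<union> S" "j \<noteq> k" and t: "t \<in> T" for j t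
    proof -
      have "j \<le> m \<or> m \<le> j \<or> rank j \<le> rank k"
        using j J insert.hyps by blast
      then have "if fst k < fst m then fst k < fst j \<or> snd j < snd k
          else fst j < fst k \<or> snd k < snd j"
        using k j(2) by (auto simp: rank_def less_eq_prod_def prod_eq_iff)
      then show ?thesis
        using corner1_fresh[OF _ t] corner2_fresh[OF _ t] by (auto simp: c_def split: if_splits)
    qed
    have same: "down T j (g'(c + k := a)) = down T j g'" if "j \<in> J \<union> S" "j \<noteq> k" for j
      using fresh that by (auto simp: down_eq_iff)
    have "k \<notin> J"
      using J k by blast
    let ?g = "g'(c + k := a)"
    have "\<forall>i. ?g i \<in> A"
      using g'(1) a(1) by simp
    moreover have "down T j ?g = down T j g" if "j \<in> J" for j
      using g'(2) same[of j] that \<open>k \<notin> J\<close> by auto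
    moreover have "down T j ?g \<in> vertices T A f" if "j \<in> J \<union> insert k S" for j
      using g'(3) a(2) same[of j] that by (cases "j = k") auto
    ultimately show ?case
      by blast
  qed
qed

text \<open>
  Uniqueness of fillings. To the upper left of \<open>m\<close>, each point of the tile at \<open>j\<close> other than the upper
  corner also lies in the tile one step to the right or in the tile one step below. Both of these
  positions are closer to \<open>m\<close>, so induction leaves only the corner, which the rest determines.
\<close>

lemma determined_by_comparable_positions:
  fixes m N :: lattice
  assumes m: "0 \<le> m" "m \<le> N"
    and g: "\<And>j. 0 \<le> j \<Longrightarrow> j \<le> N \<Longrightarrow> down T j g \<in> vertices T A f"
    and g': "\<And>j. 0 \<le> j \<Longrightarrow> j \<le> N \<Longrightarrow> down T j g' \<in> vertices T A f"
    and eq: "\<And>j. 0 \<le> j \<Longrightarrow> j \<le> N \<Longrightarrow> j \<le> m \<or> m \<le> j \<Longrightarrow> down T j g = down T j g'"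
    and j: "0 \<le> j" "j \<le> N"
  shows "down T j g = down T j g'"
  using j
proof (induction "nat (\<bar>fst j - fst m\<bar> + \<bar>snd j - snd m\<bar>)" arbitrary: j rule: less_induct)
  case less
  note ver = g[OF less.prems] g'[OF less.prems]
  \<comment> \<open>\<open>t + (j - j')\<close> is the place of the point \<open>t + j\<close> within the tile at \<open>j'\<close>.\<close>
  have step: "g (t + j) = g' (t + j)"
    if "t + (j - j') \<in> T" "0 \<le> j'" "j' \<le> N"
      "\<bar>fst j' - fst m\<bar> + \<bar>snd j' - snd m\<bar> < \<bar>fst j - fst m\<bar> + \<bar>snd j - snd m\<bar>" for j' t
  proof -
    have "down T j' g = down T j' g'"
      using that by (intro less.hyps) auto
    then have "g (t + (j - j') + j') = g' (t + (j - j') + j')"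
      using that(1) unfolding down_eq_iff by blast
    then show ?thesis
      by (simp add: algebra_simps)
  qed
  consider "j \<le> m \<or> m \<le> j" | "fst j < fst m" "snd m < snd j" | "fst m < fst j" "snd j < snd m"
    unfolding less_eq_prod_def by linarith
  then show ?case
  proof cases
    case 1
    then show ?thesis
      using eq less.prems by blast
  next
    case 2
    show ?thesis
    proof (rule corner_determined[OF ver])
      fix t assume t: "t \<in> T" "t \<noteq> corner2 T"
      show "g (t + j) = g' (t + j)"
      proof (cases "fst t = 0")
        case True
        then have "snd t < snd (corner2 T)"
          using snd_le_corner2[OF t(1)] t(2) by (auto simp: corner2_def prod_eq_iff)
        then have "t + (0, 1) \<in> T"
          using True T_nonneg[OF t(1)]
          by (intro T_hereditary[OF corner2_in_T]) (auto simp: less_eq_prod_def corner2_def)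
        then show ?thesis
          using 2 less.prems m by (intro step[of t "j - (0, 1)"]) (auto simp: less_eq_prod_def)
      next
        case False
        then have "t + (- 1, 0) \<in> T"
          using T_nonneg[OF t(1)] by (intro T_hereditary[OF t(1)]) (auto simp: less_eq_prod_def)
        then show ?thesis
          using 2 less.prems m by (intro step[of t "j + (1, 0)"]) (auto simp: less_eq_prod_def)
      qed
    qed simp
  next
    case 3
    show ?thesis
    proof (rule corner_determined[OF ver])
      fix t assume t: "t \<in> T" "t \<noteq> corner1 T"
      show "g (t + j) = g' (t + j)"
      proof (cases "snd t = 0")
        case True
        then have "fst t < fst (corner1 T)"
          using fst_le_corner1[OF t(1)] t(2) by (auto simp: corner1_def prod_eq_iff)
        then have "t + (1, 0) \<in> T"
          using True T_nonneg[OF t(1)]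
          by (intro T_hereditary[OF corner1_in_T]) (auto simp: less_eq_prod_def corner1_def)
        then show ?thesis
          using 3 less.prems m by (intro step[of t "j - (1, 0)"]) (auto simp: less_eq_prod_def)
      next
        case False
        then have "t + (0, - 1) \<in> T"
          using T_nonneg[OF t(1)] by (intro T_hereditary[OF t(1)]) (auto simp: less_eq_prod_def)
        then show ?thesis
          using 3 less.prems m by (intro step[of t "j + (0, 1)"]) (auto simp: less_eq_prod_def)
      qed
    qed simp
  qed
qed

lemma path_extensional: "l \<in> paths T A f \<Longrightarrow> snd l \<in> extensional (tile_upto T (fst l))"
  by (auto simp: paths_def PiE_def)

lemma path_nonneg: "l \<in> paths T A f \<Longrightarrow> 0 \<le> fst l"
  by (auto simp: paths_def)

lemma path_down: "l \<in> paths T A f \<Longrightarrow> 0 \<le> j \<Longrightarrow> j \<le> fst l \<Longrightarrow> down T j (snd l) \<in> vertices T A f"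
  by (cases l) (simp add: paths_def)

lemma path_value: "l \<in> paths T A f \<Longrightarrow> i \<in> tile_upto T (fst l) \<Longrightarrow> snd l i \<in> A"
  by (cases l) (auto simp: paths_def)

lemma path_eqI:
  assumes "l \<in> paths T A f" "l' \<in> paths T A f" "fst l = fst l'"
    and "\<And>j. 0 \<le> j \<Longrightarrow> j \<le> fst l \<Longrightarrow> down T j (snd l) = down T j (snd l')"
  shows "l = l'"
proof -
  have "window T (snd l) 0 (fst l) = l" "window T (snd l) 0 (fst l) = l'"
    using assms(3,4) by (simp_all add: window_eq_iff_down[OF path_extensional[OF assms(1)]]
        window_eq_iff_down[OF path_extensional[OF assms(2)]])
  then show ?thesis
    by simp
qed

lemma window_in_paths:
  assumes "0 \<le> n" and ver: "\<And>j. 0 \<le> j \<Longrightarrow> j \<le> n \<Longrightarrow> down T (a + j) g \<in> vertices T A f"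
  shows "window T g a n \<in> paths T A f"
proof -
  have "g (a + i) \<in> A" if i: "i \<in> tile_upto T n" for i
  proof -
    from i obtain t j where tj: "t \<in> T" "0 \<le> j" "j \<le> n" "i = t + j"
      by (rule tile_upto_memE)
    then have "g (t + (a + j)) \<in> A"
      using ver[of j] unfolding down_in_vertices_iff by blast
    then show ?thesis
      by (simp add: tj(4) algebra_simps)
  qed
  moreover have "down T j (snd (window T g a n)) \<in> vertices T A f" if "0 \<le> j" "j \<le> n" for j
    using that ver by (simp add: down_window)
  ultimately show ?thesis
    using assms(1) by (auto simp: paths_def window_def)
qed

text \<open>
  The two factors agree on the overlap of their domains. A point of \<open>T(d(u))\<close> that lies in the domain
  of the translate of \<open>v\<close> is at least \<open>d(u)\<close>, and as the tile is hereditary it belongs to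
  \<open>T + d(u)\<close>, where the agreement is the condition \<open>s(u) = r(v)\<close>.
\<close>

lemma common_extension:
  assumes u: "u \<in> paths T A f" and v: "v \<in> paths T A f"
    and uv: "down T (fst u) (snd u) = down T 0 (snd v)"
  obtains g where "\<And>i. g i \<in> A"
    and "\<And>j. 0 \<le> j \<Longrightarrow> j \<le> fst u \<Longrightarrow> down T j g = down T j (snd u)"
    and "\<And>j. 0 \<le> j \<Longrightarrow> j \<le> fst v \<Longrightarrow> down T (fst u + j) g = down T j (snd v)"
proof -
  obtain a where a: "a \<in> A"
    using A_nonempty by auto
  define g where "g = (\<lambda>i. if i \<in> tile_upto T (fst u) then snd u i
    else if i - fst u \<in> tile_upto T (fst v) then snd v (i - fst u) else a)"
  have "g i \<in> A" for i
    using a path_value[OF u] path_value[OF v] by (simp add: g_def)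
  moreover have "down T j g = down T j (snd u)" if "0 \<le> j" "j \<le> fst u" for j
    using tile_upto_memI[OF _ that] by (simp add: down_eq_iff g_def)
  moreover have "down T (fst u + j) g = down T j (snd v)" if j: "0 \<le> j" "j \<le> fst v" for j
    unfolding down_eq_iff
  proof
    fix t assume t: "t \<in> T"
    have i: "t + (fst u + j) - fst u = t + j"
      by simp
    show "g (t + (fst u + j)) = snd v (t + j)"
    proof (cases "t + (fst u + j) \<in> tile_upto T (fst u)")
      case True
      then obtain s k where sk: "s \<in> T" "0 \<le> k" "k \<le> fst u" "t + (fst u + j) = s + k"
        by (rule tile_upto_memE)
      from sk(3,4) T_nonneg[OF t] j have "0 \<le> t + j" "t + j \<le> s"
        by (auto simp: less_eq_prod_def prod_eq_iff)
      with sk(1) have "t + j \<in> T"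
        using T_hereditary by blast
      with uv have "snd u (t + j + fst u) = snd v (t + j + 0)"
        unfolding down_eq_iff by blast
      then show ?thesis
        using True by (simp add: g_def algebra_simps)
    next
      case False
      then show ?thesis
        unfolding g_def i using tile_upto_memI[OF t j] by simp
    qed
  qed
  ultimately show thesis
    by (rule that)
qed

theorem unique_composite:
  assumes u: "u \<in> paths T A f" and v: "v \<in> paths T A f"
    and uv: "down T (fst u) (snd u) = down T 0 (snd v)"
  shows "\<exists>!l. l \<in> paths T A f \<and> fst l = fst u + fst v \<and>
     segment T l 0 (fst u) = u \<and> segment T l (fst u) (fst u + fst v) = v"
proof -
  define m n where "m = fst u" and "n = fst v"
  have mn: "0 \<le> m" "0 \<le> n" "m \<le> m + n"
    using path_nonneg[OF u] path_nonneg[OF v] by (simp_all add: m_def n_def less_eq_prod_def)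
  have seg: "segment T l 0 (fst u) = u \<and> segment T l (fst u) (fst u + fst v) = v \<longleftrightarrow>
      (\<forall>j. 0 \<le> j \<longrightarrow> j \<le> m \<longrightarrow> down T j (snd l) = down T j (snd u)) \<and>
      (\<forall>j. 0 \<le> j \<longrightarrow> j \<le> n \<longrightarrow> down T (m + j) (snd l) = down T j (snd v))" for l
    by (simp add: segment_eq_window window_eq_iff_down path_extensional u v m_def n_def)
  show ?thesis
  proof (rule ex_ex1I)
    obtain g where g: "\<And>i. g i \<in> A"
      and gu: "\<And>j. 0 \<le> j \<Longrightarrow> j \<le> m \<Longrightarrow> down T j g = down T j (snd u)"
      and gv: "\<And>j. 0 \<le> j \<Longrightarrow> j \<le> n \<Longrightarrow> down T (m + j) g = down T j (snd v)"
      using common_extension[OF u v uv] unfolding m_def n_def by blast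
    define J where "J = {0..m} \<union> {m..m + n}"
    have J: "j \<le> m \<or> m \<le> j" if "j \<in> J" for j
      using that by (auto simp: J_def)
    have verJ: "down T j g \<in> vertices T A f" if "j \<in> J" for j
    proof (cases "j \<in> {0..m}")
      case True
      then show ?thesis
        using gu path_down[OF u] by (simp add: m_def)
    next
      case False
      with that have "j \<in> {m..m + n}"
        unfolding J_def by blast
      then have j: "m \<le> j" "j \<le> m + n"
        by simp_all
      then have "0 \<le> j - m" "j - m \<le> n"
        by (auto simp: less_eq_prod_def)
      then show ?thesis
        using gv[of "j - m"] path_down[OF v] by (simp add: n_def)
    qed
    define K where "K = {j \<in> {0..m + n}. \<not> j \<le> m \<and> \<not> m \<le> j}"
    have K: "\<not> j \<le> m \<and> \<not> m \<le> j" if "j \<in> K" for j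
      using that by (simp add: K_def)
    have "finite K"
      unfolding K_def by (rule finite_subset[OF _ finite_lattice_interval[of 0 "m + n"]]) blast
    from fill_positions[of g J m, OF g J verJ this K]
    obtain g' where g': "\<And>j. j \<in> J \<Longrightarrow> down T j g' = down T j g"
      "\<And>j. j \<in> J \<union> K \<Longrightarrow> down T j g' \<in> vertices T A f"
      by blast
    define l where "l = window T g' 0 (m + n)"
    have "down T j g' \<in> vertices T A f" if "0 \<le> j" "j \<le> m + n" for j
      using that g'(2)[of j] by (cases "j \<le> m \<or> m \<le> j") (auto simp: J_def K_def)
    then have "l \<in> paths T A f"
      unfolding l_def using mn by (intro window_in_paths) (auto simp: less_eq_prod_def)
    moreover have "down T j (snd l) = down T j (snd u)" if j: "0 \<le> j" "j \<le> m" for j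
    proof -
      have "j \<le> m + n"
        using j mn by (auto simp: less_eq_prod_def)
      then show ?thesis
        using j g'(1)[of j] gu[of j] by (simp add: l_def down_window J_def)
    qed
    moreover have "down T (m + j) (snd l) = down T j (snd v)" if j: "0 \<le> j" "j \<le> n" for j
    proof -
      have "0 \<le> m + j" "m \<le> m + j" "m + j \<le> m + n"
        using j mn by (auto simp: less_eq_prod_def)
      then show ?thesis
        using g'(1)[of "m + j"] gv[OF j] by (simp add: l_def down_window J_def)
    qed
    moreover have "fst l = fst u + fst v"
      by (simp add: l_def m_def n_def)
    ultimately show "\<exists>l. l \<in> paths T A f \<and> fst l = fst u + fst v \<and>
        segment T l 0 (fst u) = u \<and> segment T l (fst u) (fst u + fst v) = v"
      unfolding seg by blast
  next
    fix l l'
    assume "l \<in> paths T A f \<and> fst l = fst u + fst v \<and>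
        segment T l 0 (fst u) = u \<and> segment T l (fst u) (fst u + fst v) = v"
      and "l' \<in> paths T A f \<and> fst l' = fst u + fst v \<and>
        segment T l' 0 (fst u) = u \<and> segment T l' (fst u) (fst u + fst v) = v"
    then have l: "l \<in> paths T A f" "fst l = m + n"
        "\<And>j. 0 \<le> j \<Longrightarrow> j \<le> m \<Longrightarrow> down T j (snd l) = down T j (snd u)"
        "\<And>j. 0 \<le> j \<Longrightarrow> j \<le> n \<Longrightarrow> down T (m + j) (snd l) = down T j (snd v)"
      and l': "l' \<in> paths T A f" "fst l' = m + n"
        "\<And>j. 0 \<le> j \<Longrightarrow> j \<le> m \<Longrightarrow> down T j (snd l') = down T j (snd u)"
        "\<And>j. 0 \<le> j \<Longrightarrow> j \<le> n \<Longrightarrow> down T (m + j) (snd l') = down T j (snd v)"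
      unfolding seg by (simp_all add: m_def n_def)
    have same: "down T j (snd l) = down T j (snd l')"
      if "0 \<le> j" "j \<le> m + n" "j \<le> m \<or> m \<le> j" for j
    proof (cases "j \<le> m")
      case True
      then show ?thesis
        using that l(3) l'(3) by simp
    next
      case False
      with that have "0 \<le> j - m" "j - m \<le> n"
        by (auto simp: less_eq_prod_def)
      then show ?thesis
        using l(4)[of "j - m"] l'(4)[of "j - m"] by simp
    qed
    show "l = l'"
    proof (rule path_eqI[OF l(1) l'(1)])
      show "fst l = fst l'"
        by (simp add: l(2) l'(2))
      fix j assume "0 \<le> j" "j \<le> fst l"
      then show "down T j (snd l) = down T j (snd l')"
        using determined_by_comparable_positions[OF mn(1,3) _ _ same]
          path_down[OF l(1)] path_down[OF l'(1)] l(2) l'(2) by auto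
    qed
  qed
qed

lemma path_comp_eqI:
  assumes "u \<in> paths T A f" "v \<in> paths T A f" "down T (fst u) (snd u) = down T 0 (snd v)"
    and "l \<in> paths T A f" "fst l = fst u + fst v"
      "segment T l 0 (fst u) = u" "segment T l (fst u) (fst u + fst v) = v"
  shows "path_comp T A f u v = l"
  unfolding path_comp_def using assms by (intro the1_equality unique_composite) auto

lemma segment_path_comp:
  assumes "u \<in> paths T A f" "v \<in> paths T A f" "down T (fst u) (snd u) = down T 0 (snd v)"
  shows "segment T (path_comp T A f u v) 0 (fst u) = u"
  using theI'[OF unique_composite[OF assms]] unfolding path_comp_def by blast

section \<open>Infinite paths and configurations\<close>

abbreviation "\<Lambda> \<equiv> graph_BD T A f"
abbreviation "Y \<equiv> shift_space T A f"

text \<open>The structure maps of the two graphs are expanded once, so that the composition law becomes a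
  statement about triples \<open>m \<le> k \<le> n\<close>.\<close>

lemma two_sided_paths_iff:
  "x \<in> two_sided_paths \<Lambda> \<longleftrightarrow>
     fst x \<in> UNIV \<rightarrow> vertices T A f \<and>
     snd x \<in> {(m, n). m \<le> n} \<rightarrow>\<^sub>E paths T A f \<and>
     (\<forall>m n. m \<le> n \<longrightarrow> down T 0 (snd (snd x (m, n))) = fst x m \<and>
        down T (fst (snd x (m, n))) (snd (snd x (m, n))) = fst x n) \<and>
     (\<forall>n. snd x (n, n) = (0, fst x n)) \<and>
     (\<forall>m k n. m \<le> k \<longrightarrow> k \<le> n \<longrightarrow>
        snd x (m, n) = path_comp T A f (snd x (m, k)) (snd x (k, n))) \<and>
     (\<forall>m n. m \<le> n \<longrightarrow> fst (snd x (m, n)) = n - m)"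
proof -
  have mors: "(\<forall>u\<in>{(m, n). m \<le> n}. P u) \<longleftrightarrow> (\<forall>m n. m \<le> n \<longrightarrow> P (m, n))"
    for P :: "lattice \<times> lattice \<Rightarrow> bool"
  proof
    assume R: "\<forall>m n. m \<le> n \<longrightarrow> P (m, n)"
    show "\<forall>u\<in>{(m, n). m \<le> n}. P u"
    proof
      fix u :: "lattice \<times> lattice" assume "u \<in> {(m, n). m \<le> n}"
      with R[rule_format, of "fst u" "snd u"] show "P u"
        by (simp add: case_prod_unfold)
    qed
  qed simp
  have comp: "(\<forall>m k. m \<le> k \<longrightarrow> (\<forall>k' n. k' \<le> n \<longrightarrow> k = k' \<longrightarrow> Q m k k' n)) \<longleftrightarrow>
    (\<forall>m k n. m \<le> k \<longrightarrow> k \<le> n \<longrightarrow> Q m k k n)"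
    for Q :: "lattice \<Rightarrow> lattice \<Rightarrow> lattice \<Rightarrow> lattice \<Rightarrow> bool"
    by blast
  show ?thesis
    unfolding two_sided_paths_def is_functor_def degree_preserving_def graph_BD_def Delta_def
      mem_Collect_eq graph2.select_convs mors fst_conv snd_conv PiE_UNIV_domain
      comp ball_UNIV conj_assoc
    by (rule refl)
qed

lemma two_sided_pathsD:
  assumes x: "x \<in> two_sided_paths \<Lambda>"
  shows "fst x n \<in> vertices T A f"
    and "snd x \<in> extensional {(m, n). m \<le> n}"
    and "m \<le> n \<Longrightarrow> snd x (m, n) \<in> paths T A f"
    and "m \<le> n \<Longrightarrow> fst (snd x (m, n)) = n - m"
    and "m \<le> n \<Longrightarrow> down T 0 (snd (snd x (m, n))) = fst x m"
    and "m \<le> n \<Longrightarrow> down T (n - m) (snd (snd x (m, n))) = fst x n"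
    and "snd x (n, n) = (0, fst x n)"
    and "m \<le> k \<Longrightarrow> k \<le> n \<Longrightarrow> snd x (m, n) = path_comp T A f (snd x (m, k)) (snd x (k, n))"
proof -
  note 1 = x[unfolded two_sided_paths_iff]
  note 2 = 1[THEN conjunct2] note 3 = 2[THEN conjunct2] note 4 = 3[THEN conjunct2]
  note 5 = 4[THEN conjunct2]
  show "fst x n \<in> vertices T A f"
    using 1[THEN conjunct1] by (rule funcset_mem) simp
  show "snd x \<in> extensional {(m, n). m \<le> n}"
    using 2[THEN conjunct1] by (simp add: PiE_def)
  show "snd x (m, n) \<in> paths T A f" if "m \<le> n"
    using 2[THEN conjunct1] by (rule PiE_mem) (simp add: that)
  show deg: "fst (snd x (m, n)) = n - m" if "m \<le> n"
    using 5[THEN conjunct2] that by simp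
  show "down T 0 (snd (snd x (m, n))) = fst x m" if "m \<le> n"
    using 3[THEN conjunct1] that by simp
  show "down T (n - m) (snd (snd x (m, n))) = fst x n" if "m \<le> n"
    using 3[THEN conjunct1, rule_format, OF that, THEN conjunct2] by (simp only: deg[OF that])
  show "snd x (n, n) = (0, fst x n)"
    using 4[THEN conjunct1] by (rule spec)
  show "snd x (m, n) = path_comp T A f (snd x (m, k)) (snd x (k, n))" if "m \<le> k" "k \<le> n"
    using 5[THEN conjunct1, rule_format, OF that] .
qed

text \<open>The first factor of \<open>x(m, n) = x(m, k) x(k, n)\<close> is an initial segment of the composite, and its
  source is the vertex \<open>x(k)\<close>.\<close>

lemma down_infinite_path:
  assumes x: "x \<in> two_sided_paths \<Lambda>" and mkn: "m \<le> k" "k \<le> n"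
  shows "down T (k - m) (snd (snd x (m, n))) = fst x k"
proof -
  have km: "0 \<le> k - m"
    using mkn(1) by (simp add: less_eq_prod_def)
  note path = two_sided_pathsD(3)[OF x] and deg = two_sided_pathsD(4)[OF x]
    and rng = two_sided_pathsD(5)[OF x] and src = two_sided_pathsD(6)[OF x]
  have "segment T (snd x (m, n)) 0 (fst (snd x (m, k))) = snd x (m, k)"
    unfolding two_sided_pathsD(8)[OF x mkn]
    by (rule segment_path_comp[OF path[OF mkn(1)] path[OF mkn(2)]])
       (simp only: deg[OF mkn(1)] src[OF mkn(1)] rng[OF mkn(2)])
  then have "window T (snd (snd x (m, n))) 0 (k - m) = snd x (m, k)"
    by (simp add: segment_eq_window deg[OF mkn(1)])
  from down_window[OF km order_refl, of T "snd (snd x (m, n))" 0, unfolded this]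
  show ?thesis
    by (simp add: src[OF mkn(1)])
qed

definition config :: "(lattice \<Rightarrow> 'a, 'a path) inf_path \<Rightarrow> lattice \<Rightarrow> 'a" where
  "config x = (\<lambda>i. fst x i 0)"

definition unfold_config :: "(lattice \<Rightarrow> 'a) \<Rightarrow> (lattice \<Rightarrow> 'a, 'a path) inf_path" where
  "unfold_config y =
     ((\<lambda>n. down T n y), restrict (\<lambda>(m, n). window T y m (n - m)) {(m, n). m \<le> n})"

text \<open>The vertices at \<open>n\<close> and at \<open>n + t\<close> meet in the path from \<open>n\<close> to \<open>n + t\<close>, whose value at \<open>t\<close>
  is an entry of both.\<close>

lemma down_config:
  assumes x: "x \<in> two_sided_paths \<Lambda>"
  shows "down T n (config x) = fst x n"
proof -
  have ends: "down T 0 (snd (snd x (n, n + t))) = fst x n"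
    "down T t (snd (snd x (n, n + t))) = fst x (n + t)" if "t \<in> T" for t
    using down_infinite_path[OF x, of n n "n + t"] down_infinite_path[OF x, of n "n + t" "n + t"]
      T_nonneg[OF that] by (auto simp: less_eq_prod_def)
  have "fst x (t + n) 0 = fst x n t" if t: "t \<in> T" for t
  proof -
    have "fst x n t = snd (snd x (n, n + t)) t"
      using ends(1)[OF t, symmetric] t by (simp add: down_def)
    moreover have "fst x (n + t) 0 = snd (snd x (n, n + t)) t"
      using ends(2)[OF t, symmetric] T_0 by (simp add: down_def)
    ultimately show ?thesis
      by (simp add: add.commute)
  qed
  then have "down T n (config x) = down T 0 (fst x n)"
    unfolding down_eq_iff config_def by simp
  also have "\<dots> = fst x n"
    using two_sided_pathsD(5)[OF x, of n n] two_sided_pathsD(7)[OF x, of n] by simp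
  finally show ?thesis .
qed

lemma config_in_shift_space:
  assumes x: "x \<in> two_sided_paths \<Lambda>"
  shows "config x \<in> Y"
proof -
  have ver: "down T n (config x) \<in> vertices T A f" for n
    unfolding down_config[OF x] by (rule two_sided_pathsD(1)[OF x])
  have "config x n \<in> A" for n
    using ver[of n, unfolded down_in_vertices_iff] T_0 by auto
  with ver show ?thesis
    by (simp add: shift_space_def PiE_UNIV_domain Pi_iff)
qed

text \<open>A path is known from its tile patterns, and those of \<open>x(m, n)\<close> are vertices of \<open>x\<close>, that is,
  patterns of the configuration.\<close>

lemma unfold_config_config:
  assumes x: "x \<in> two_sided_paths \<Lambda>"
  shows "unfold_config (config x) = x"
proof (rule prod_eqI)
  show "fst (unfold_config (config x)) = fst x"
    by (simp add: unfold_config_def down_config[OF x])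
  show "snd (unfold_config (config x)) = snd x"
  proof
    fix mn :: "lattice \<times> lattice"
    obtain m n where mn: "mn = (m, n)"
      by (cases mn)
    show "snd (unfold_config (config x)) mn = snd x mn"
    proof (cases "m \<le> n")
      case True
      note p = two_sided_pathsD(3)[OF x True] and deg = two_sided_pathsD(4)[OF x True]
      have "down T (m + j) (config x) = down T j (snd (snd x (m, n)))"
        if "0 \<le> j" "j \<le> n - m" for j
      proof -
        have "m \<le> m + j" "m + j \<le> n"
          using that by (auto simp: less_eq_prod_def)
        from down_infinite_path[OF x this] show ?thesis
          by (simp add: down_config[OF x])
      qed
      then have "window T (config x) m (n - m) = snd x (m, n)"
        by (simp add: window_eq_iff_down[OF path_extensional[OF p]] deg)
      with True show ?thesis
        by (simp add: unfold_config_def mn)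
    next
      case False
      then show ?thesis
        using two_sided_pathsD(2)[OF x] by (simp add: unfold_config_def mn extensional_def)
    qed
  qed
qed

lemma window_config_in_paths:
  assumes "y \<in> Y" "0 \<le> n"
  shows "window T y m n \<in> paths T A f"
  using assms by (intro window_in_paths) (simp_all add: shift_space_def)

text \<open>Functoriality is the uniqueness half of \<open>unique_composite\<close>: the part of \<open>y\<close> between \<open>m\<close> and \<open>n\<close>
  has the parts between \<open>m\<close>, \<open>k\<close> and \<open>n\<close> as its segments, hence it is their composite.\<close>

lemma unfold_config_in_two_sided_paths:
  assumes y: "y \<in> Y"
  shows "unfold_config y \<in> two_sided_paths \<Lambda>"
proof -
  have nonneg: "0 \<le> n - m" if "m \<le> n" for m n :: lattice
    using that by (simp add: less_eq_prod_def)
  have win: "window T y m (n - m) \<in> paths T A f" if "m \<le> n" for m n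
    using window_config_in_paths[OF y nonneg[OF that]] .
  have down_win: "down T j (snd (window T y m (n - m))) = down T (m + j) y"
    if "0 \<le> j" "j \<le> n - m" for j m n
    using that by (rule down_window)
  have comp: "path_comp T A f (window T y m (k - m)) (window T y k (n - k)) = window T y m (n - m)"
    if mk: "m \<le> k" and kn: "k \<le> n" for m k n
  proof (rule path_comp_eqI)
    have mn: "m \<le> n"
      using mk kn by (rule order_trans)
    note [simp] = nonneg[OF mk] nonneg[OF kn] nonneg[OF mn]
    have sub: "j \<le> n - m" if "j \<le> k - m" for j
      using that kn by (auto simp: less_eq_prod_def)
    show "window T y m (k - m) \<in> paths T A f" "window T y k (n - k) \<in> paths T A f"
      "window T y m (n - m) \<in> paths T A f"
      using mk kn mn by (simp_all add: win)
    show "down T (fst (window T y m (k - m))) (snd (window T y m (k - m))) =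
        down T 0 (snd (window T y k (n - k)))"
      by (simp add: down_window)
    show "fst (window T y m (n - m)) = fst (window T y m (k - m)) + fst (window T y k (n - k))"
      by simp
    show "segment T (window T y m (n - m)) 0 (fst (window T y m (k - m))) = window T y m (k - m)"
      using sub by (simp add: segment_eq_window down_window
          window_eq_iff_down[OF path_extensional[OF win[OF mk]]])
    show "segment T (window T y m (n - m)) (fst (window T y m (k - m)))
        (fst (window T y m (k - m)) + fst (window T y k (n - k))) = window T y k (n - k)"
    proof -
      have "down T (k - m + j) (snd (window T y m (n - m))) = down T j (snd (window T y k (n - k)))"
        if j: "0 \<le> j" "j \<le> n - k" for j
      proof -
        have "0 \<le> k - m + j" "k - m + j \<le> n - m"
          using j mk by (auto simp: less_eq_prod_def)
        then show ?thesis
          using j by (simp add: down_window)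
      qed
      then show ?thesis
        by (simp add: segment_eq_window window_eq_iff_down[OF path_extensional[OF win[OF kn]]])
    qed
  qed
  have snd_eq: "snd (unfold_config y) (m, n) = window T y m (n - m)" if "m \<le> n" for m n
    using that by (simp add: unfold_config_def)
  have fst_eq: "fst (unfold_config y) n = down T n y" for n
    by (simp add: unfold_config_def)
  have ident: "window T y n 0 = (0, down T n y)" for n
    by (simp add: window_def tile_upto_0 down_def add.commute)
  show ?thesis
    unfolding two_sided_paths_iff
  proof (intro conjI allI impI)
    show "fst (unfold_config y) \<in> UNIV \<rightarrow> vertices T A f"
      using y by (simp add: Pi_iff fst_eq shift_space_def)
    show "snd (unfold_config y) \<in> {(m, n). m \<le> n} \<rightarrow>\<^sub>E paths T A f"
      by (simp add: unfold_config_def restrict_PiE_iff case_prod_unfold win)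
  next
    fix m n :: lattice assume mn: "m \<le> n"
    note [simp] = nonneg[OF mn] snd_eq[OF mn]
    show "down T 0 (snd (snd (unfold_config y) (m, n))) = fst (unfold_config y) m"
      by (simp add: fst_eq down_window)
    show "down T (fst (snd (unfold_config y) (m, n))) (snd (snd (unfold_config y) (m, n))) =
        fst (unfold_config y) n"
      by (simp add: fst_eq down_window)
    show "fst (snd (unfold_config y) (m, n)) = n - m"
      by simp
  next
    fix n show "snd (unfold_config y) (n, n) = (0, fst (unfold_config y) n)"
      by (simp add: snd_eq fst_eq ident)
  next
    fix m k n :: lattice assume mk: "m \<le> k" and kn: "k \<le> n"
    show "snd (unfold_config y) (m, n) =
        path_comp T A f (snd (unfold_config y) (m, k)) (snd (unfold_config y) (k, n))"
      by (simp add: snd_eq[OF mk] snd_eq[OF kn] snd_eq[OF order_trans[OF mk kn]] comp[OF mk kn])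
  qed
qed

lemma config_unfold_config: "config (unfold_config y) = y"
  using T_0 by (simp add: config_def unfold_config_def down_def)

section \<open>Continuity\<close>

lemma cylinder_iff:
  "x \<in> cylinder \<Lambda> l n \<longleftrightarrow> x \<in> two_sided_paths \<Lambda> \<and> snd x (n, n + fst l) = l"
  by (simp add: cylinder_def graph_BD_def)

lemma vertex_in_cylinder:
  assumes x: "x \<in> two_sided_paths \<Lambda>"
  shows "snd x (n, n) \<in> paths T A f" "snd x (n, n) = (0, fst x n)"
    "x \<in> cylinder \<Lambda> (snd x (n, n)) n"
  using x two_sided_pathsD(3)[OF x, of n n] two_sided_pathsD(7)[OF x, of n]
  by (simp_all add: cylinder_iff)

lemma topspace_two_sided_topology: "topspace (two_sided_topology \<Lambda>) = two_sided_paths \<Lambda>"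
proof -
  have "mors \<Lambda> = paths T A f"
    by (simp add: graph_BD_def)
  then show ?thesis
    unfolding two_sided_topology_def topology_generated_by_topspace
    using vertex_in_cylinder cylinder_iff by blast
qed

lemma topspace_shift_topology: "topspace (shift_topology T A f) = Y"
  by (auto simp: shift_topology_def shift_space_def)

lemma openin_cylinder: "l \<in> paths T A f \<Longrightarrow> openin (two_sided_topology \<Lambda>) (cylinder \<Lambda> l n)"
  unfolding two_sided_topology_def
  by (rule topology_generated_by_Basis) (auto simp: graph_BD_def)

text \<open>The value at \<open>i\<close> is read off the identity path at \<open>x(i)\<close>, so its level sets are unions of
  cylinder sets of degree \<open>0\<close>.\<close>

lemma continuous_map_config:
  "continuous_map (two_sided_topology \<Lambda>) (shift_topology T A f) config"
proof -
  have "continuous_map (two_sided_topology \<Lambda>) (discrete_topology A) (\<lambda>x. config x i)" for i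
    unfolding continuous_map_def topspace_two_sided_topology
  proof (intro conjI allI impI)
    show "(\<lambda>x. config x i) \<in> two_sided_paths \<Lambda> \<rightarrow> topspace (discrete_topology A)"
      using config_in_shift_space by (auto simp: shift_space_def)
    fix U
    have "{x \<in> two_sided_paths \<Lambda>. config x i \<in> U} =
        (\<Union>l\<in>{l \<in> paths T A f. fst l = 0 \<and> snd l 0 \<in> U}. cylinder \<Lambda> l i)"
    proof (intro equalityI subsetI)
      fix x assume "x \<in> {x \<in> two_sided_paths \<Lambda>. config x i \<in> U}"
      then show "x \<in> (\<Union>l\<in>{l \<in> paths T A f. fst l = 0 \<and> snd l 0 \<in> U}. cylinder \<Lambda> l i)"
        using vertex_in_cylinder[of x i]
        by (intro UN_I[of "snd x (i, i)"]) (auto simp: config_def)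
    next
      fix x assume "x \<in> (\<Union>l\<in>{l \<in> paths T A f. fst l = 0 \<and> snd l 0 \<in> U}. cylinder \<Lambda> l i)"
      then obtain l where l: "fst l = 0" "snd l 0 \<in> U" "x \<in> cylinder \<Lambda> l i"
        by blast
      then have "x \<in> two_sided_paths \<Lambda>" "snd x (i, i) = l"
        by (simp_all add: cylinder_iff)
      with l(2) vertex_in_cylinder(2)[of x i]
      show "x \<in> {x \<in> two_sided_paths \<Lambda>. config x i \<in> U}"
        by (auto simp: config_def)
    qed
    moreover have "openin (two_sided_topology \<Lambda>)
        (\<Union>l\<in>{l \<in> paths T A f. fst l = 0 \<and> snd l 0 \<in> U}. cylinder \<Lambda> l i)"
    proof (rule openin_Union)
      fix S assume "S \<in> (\<lambda>l. cylinder \<Lambda> l i) ` {l \<in> paths T A f. fst l = 0 \<and> snd l 0 \<in> U}"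
      then obtain l where "l \<in> paths T A f" "S = cylinder \<Lambda> l i"
        by blast
      then show "openin (two_sided_topology \<Lambda>) S"
        by (simp add: openin_cylinder)
    qed
    ultimately show "openin (two_sided_topology \<Lambda>) {x \<in> two_sided_paths \<Lambda>. config x i \<in> U}"
      by simp
  qed
  then show ?thesis
    using config_in_shift_space
    by (auto simp: shift_topology_def continuous_map_in_subtopology
        continuous_map_componentwise_UNIV topspace_two_sided_topology)
qed

text \<open>The preimage of a cylinder set fixes the values at the finitely many points of \<open>T(d(l)) + n\<close>,
  and is therefore open in the product topology.\<close>

lemma continuous_map_unfold_config:
  "continuous_map (shift_topology T A f) (two_sided_topology \<Lambda>) unfold_config"
  unfolding two_sided_topology_def
proof (rule continuous_on_generated_topo)
  show "unfold_config ` topspace (shift_topology T A f) \<subseteq>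
      \<Union> {cylinder \<Lambda> l n |l n. l \<in> mors \<Lambda>}"
    using unfold_config_in_two_sided_paths topspace_two_sided_topology
    unfolding topspace_shift_topology two_sided_topology_def topology_generated_by_topspace by blast
  fix U assume "U \<in> {cylinder \<Lambda> l n |l n. l \<in> mors \<Lambda>}"
  then obtain l n where U: "U = cylinder \<Lambda> l n" and l: "l \<in> paths T A f"
    by (auto simp: graph_BD_def)
  let ?Y = "shift_topology T A f"
  have "n \<le> n + fst l"
    using path_nonneg[OF l] by (simp add: less_eq_prod_def)
  then have "unfold_config y \<in> U \<longleftrightarrow> (\<forall>i\<in>tile_upto T (fst l). y (n + i) = snd l i)" if "y \<in> Y" for y
    using unfold_config_in_two_sided_paths[OF that]
    by (simp add: U cylinder_iff unfold_config_def window_eq_iff[OF path_extensional[OF l]])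
  then have eq: "unfold_config -` U \<inter> topspace ?Y =
      (\<Inter>i\<in>tile_upto T (fst l). {y \<in> topspace ?Y. y (n + i) \<in> {snd l i}}) \<inter> topspace ?Y"
    unfolding topspace_shift_topology by blast
  have "openin ?Y {y \<in> topspace ?Y. y (n + i) \<in> {snd l i}}" if "i \<in> tile_upto T (fst l)" for i
  proof (rule openin_continuous_map_preimage)
    show "continuous_map ?Y (discrete_topology A) (\<lambda>y. y (n + i))"
      unfolding shift_topology_def
      by (intro continuous_map_from_subtopology continuous_map_product_projection) simp
    show "openin (discrete_topology A) {snd l i}"
      using path_value[OF l that] by simp
  qed
  then show "openin ?Y (unfold_config -` U \<inter> topspace ?Y)"
    unfolding eq by (intro openin_INT finite_tile_upto finite_T)
qed

lemma homeomorphic_map_config: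
  "homeomorphic_map (two_sided_topology \<Lambda>) (shift_topology T A f) config"
  unfolding homeomorphic_map_maps homeomorphic_maps_def
  using continuous_map_config continuous_map_unfold_config unfold_config_config config_unfold_config
  by (auto simp: topspace_two_sided_topology)

lemma lattice_shift_config: "lattice_shift b (config x) = config (path_shift b x)"
  by (simp add: lattice_shift_def config_def path_shift_def)

end

theorem theorem6p1:
  fixes T :: "lattice set" and A :: "'a set" and f :: "(lattice \<Rightarrow> 'a) \<Rightarrow> 'a \<Rightarrow> 'a"
  assumes "basic_data T A f"
  shows "\<exists>h. homeomorphic_map (two_sided_topology (graph_BD T A f)) (shift_topology T A f) h \<and>
    (\<forall>b. \<forall>x \<in> two_sided_paths (graph_BD T A f).
       lattice_shift b (h x) = h (path_shift b x))"
proof -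
  interpret basic_data_graph T A f
    by unfold_locales (rule assms)
  show ?thesis
    using homeomorphic_map_config lattice_shift_config by blast
qed

end
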